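(* Let $q$ be a positive integer and let $A_q=(c_q(m-n))_{m,n=1}^q$ be the $q\times q$ matrix whose $(m,n)$ entry is the Ramanujan sum $c_q(m-n)$. Then the characteristic polynomial of $A_q$ is \[ \det(\lambda E_q-A_q)=\lambda^{q-\varphi(q)}(\lambda-q)^{\varphi(q)}. \] In particular, $A_q$ has eigenvalues $0$ and $q$ with multiplicities $q-\varphi(q)$ and $\varphi(q)$, respectively.
   Context: For a positive integer $q$ and any integer $n$, the Ramanujan sum is $c_q(n)=\sum_{1\le k\le q,\ \gcd(k,q)=1}\exp(2\pi i kn/q)$. $\varphi$ is Euler's totient function and $E_q$ is the $q\times q$ identity matrix. *)

theory Defs
  imports Complex_Main "HOL-Number_Theory.Totient" "Jordan_Normal_Form.Char_Poly"
begin

definition ramanujan_sum :: "nat \<Rightarrow> int \<Rightarrow> complex" where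
  "ramanujan_sum q n =
     (\<Sum>k | 1 \<le> k \<and> k \<le> q \<and> gcd k q = 1.
        exp (2 * of_real pi * \<i> * of_nat k * of_int n / of_nat q))"

(* Library matrices are indexed by {0..<q}; the shift by 1 gives the index range {1..q}. *)
definition ramanujan_mat :: "nat \<Rightarrow> complex mat" where
  "ramanujan_mat q = mat q q (\<lambda>(i, j). ramanujan_sum q (int (i + 1) - int (j + 1)))"

end

(* The columns of the discrete Fourier matrix, with entries u_i^k where u_i = exp(2 pi i/q),
   diagonalise A_q: the definition of the Ramanujan sum reads
   c_q(i-j) = (sum over k coprime to q) u_i^k * u_j^(-k), so A_q = P D P^(-1) where D has
   the entry q at the indices coprime to q and 0 elsewhere. *)
theory Submission
  imports Defs
begin

definition unity_root :: "nat \<Rightarrow> nat \<Rightarrow> complex" where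
  "unity_root q i = cis (2 * pi * real i / real q)"

text \<open>The exponent is \<open>Suc k\<close> because column \<open>k\<close>, counted from 0,
  stands for the summation index k + 1 in the range 1..q of the Ramanujan sum.\<close>

definition fourier_mat :: "nat \<Rightarrow> complex mat" where
  "fourier_mat q = mat q q (\<lambda>(i, k). unity_root q i ^ Suc k)"

text \<open>Since roots of unity have modulus 1, this is the conjugate transpose of
  \<open>fourier_mat q\<close> divided by q, written without conjugation.\<close>

definition inverse_fourier_mat :: "nat \<Rightarrow> complex mat" where
  "inverse_fourier_mat q = mat q q (\<lambda>(k, j). inverse (unity_root q j) ^ Suc k / of_nat q)"

definition ramanujan_diag :: "nat \<Rightarrow> nat \<Rightarrow> complex" where
  "ramanujan_diag q k = (if coprime (Suc k) q then of_nat q else 0)"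

definition ramanujan_diag_mat :: "nat \<Rightarrow> complex mat" where
  "ramanujan_diag_mat q = mat q q (\<lambda>(i, j). if i = j then ramanujan_diag q i else 0)"

lemma unity_root_nonzero [simp]: "unity_root q i \<noteq> 0"
  by (simp add: unity_root_def)

lemma unity_root_power:
  assumes "q > 0"
  shows "unity_root q i ^ q = 1"
  using assms cis_multiple_2pi[of "real i"] by (simp add: unity_root_def DeMoivre)

lemma unity_root_inj:
  assumes "i < q" "j < q" "unity_root q i = unity_root q j"
  shows "i = j"
proof -
  have "inj_on (unity_root q) {..<q}"
    using bij_betw_roots_unity[of q] assms
    by (simp add: bij_betw_def unity_root_def[abs_def])
  with assms show ?thesis
    by (auto dest: inj_onD)
qed

text \<open>Starting at exponent 1 only multiplies the geometric sum by z, and for z \<noteq> 1 that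
  sum is (z^q - 1)/(z - 1) = 0.\<close>

lemma sum_Suc_powers_root_of_unity:
  fixes z :: "'a :: field"
  assumes "z ^ q = 1"
  shows "(\<Sum>k<q. z ^ Suc k) = (if z = 1 then of_nat q else 0)"
proof (cases "z = 1")
  case False
  then show ?thesis
    using assms geometric_sum[of z q] by (simp flip: sum_distrib_left)
qed simp

text \<open>Orthogonality of the characters of Z/q: the quotient is again a q-th root of unity, and
  it is 1 only on the diagonal because the q roots are distinct.\<close>

lemma sum_unity_root_quotient:
  assumes "i < q" "j < q"
  shows "(\<Sum>k<q. (unity_root q i / unity_root q j) ^ Suc k) = (if i = j then of_nat q else 0)"
proof -
  have "(unity_root q i / unity_root q j) ^ q = 1"
    using assms by (simp add: power_divide unity_root_power)
  moreover have "unity_root q i / unity_root q j = 1 \<longleftrightarrow> i = j"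
    using assms unity_root_inj by auto
  ultimately show ?thesis
    by (simp only: sum_Suc_powers_root_of_unity)
qed

lemma ramanujan_sum_eq:
  "ramanujan_sum q (int (i + 1) - int (j + 1)) =
     (\<Sum>k<q. if coprime (Suc k) q then (unity_root q i / unity_root q j) ^ Suc k else 0)"
proof -
  \<comment> \<open>The two index shifts by 1 cancel in the difference, so the exponential depends
    on i - j alone and splits into a quotient of roots.\<close>
  have root: "(unity_root q i / unity_root q j) ^ k =
      exp (2 * of_real pi * \<i> * of_nat k * of_int (int (i + 1) - int (j + 1)) / of_nat q)" for k
    by (simp add: unity_root_def cis_conv_exp diff_divide_distrib right_diff_distrib mult_ac
        flip: exp_diff exp_of_nat_mult)
  have "ramanujan_sum q (int (i + 1) - int (j + 1)) =
      (\<Sum>k\<in>{1..q}. if coprime k q then (unity_root q i / unity_root q j) ^ k else 0)"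
    \<comment> \<open>Padding with zeros turns the sum over totatives into one over a full range,
      the shape of a matrix product with a diagonal factor.\<close>
    unfolding ramanujan_sum_def root[symmetric]
    by (rule sum.mono_neutral_cong_left) (auto simp: coprime_iff_gcd_eq_1)
  also have "\<dots> = (\<Sum>k<q. if coprime (Suc k) q
      then (unity_root q i / unity_root q j) ^ Suc k else 0)"
    by (rule sum.reindex_bij_witness[of _ Suc "\<lambda>k. k - 1"]) auto
  finally show ?thesis .
qed

lemma fourier_mat_inverse:
  assumes "q > 0"
  shows "fourier_mat q * inverse_fourier_mat q = 1\<^sub>m q"
proof (rule eq_matI)
  fix i j assume "i < dim_row (1\<^sub>m q :: complex mat)" "j < dim_col (1\<^sub>m q :: complex mat)"
  then have ij: "i < q" "j < q" by auto
  have "(fourier_mat q * inverse_fourier_mat q) $$ (i, j) =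
      (\<Sum>k<q. (unity_root q i / unity_root q j) ^ Suc k) / of_nat q"
    using ij unfolding sum_divide_distrib
    by (auto simp: fourier_mat_def inverse_fourier_mat_def scalar_prod_def lessThan_atLeast0
        power_divide field_simps intro!: sum.cong)
  then show "(fourier_mat q * inverse_fourier_mat q) $$ (i, j) = 1\<^sub>m q $$ (i, j)"
    using ij assms by (simp add: sum_unity_root_quotient del: power_Suc)
qed (auto simp: fourier_mat_def inverse_fourier_mat_def)

lemma fourier_mat_times_diag:
  "fourier_mat q * ramanujan_diag_mat q =
     mat q q (\<lambda>(i, k). unity_root q i ^ Suc k * ramanujan_diag q k)"
  by (rule eq_matI)
    (auto simp: fourier_mat_def ramanujan_diag_mat_def scalar_prod_def if_distrib sum.delta
      cong: if_cong)

lemma ramanujan_mat_factorization: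
  assumes "q > 0"
  shows "ramanujan_mat q = fourier_mat q * ramanujan_diag_mat q * inverse_fourier_mat q"
proof (rule eq_matI)
  fix i j
  assume "i < dim_row (fourier_mat q * ramanujan_diag_mat q * inverse_fourier_mat q)"
    "j < dim_col (fourier_mat q * ramanujan_diag_mat q * inverse_fourier_mat q)"
  then have ij: "i < q" "j < q" by (auto simp: fourier_mat_def inverse_fourier_mat_def)
  have "(fourier_mat q * ramanujan_diag_mat q * inverse_fourier_mat q) $$ (i, j) =
      (\<Sum>k<q. unity_root q i ^ Suc k * ramanujan_diag q k *
        (inverse (unity_root q j) ^ Suc k / of_nat q))"
    using ij unfolding fourier_mat_times_diag
    by (auto simp: inverse_fourier_mat_def scalar_prod_def lessThan_atLeast0 intro!: sum.cong)
  \<comment> \<open>The diagonal entry q cancels the normalisation 1/q of the inverse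
    matrix.\<close>
  also have "\<dots> = (\<Sum>k<q. if coprime (Suc k) q
      then (unity_root q i / unity_root q j) ^ Suc k else 0)"
    using assms by (intro sum.cong) (auto simp: ramanujan_diag_def power_divide field_simps)
  finally show "ramanujan_mat q $$ (i, j) =
      (fourier_mat q * ramanujan_diag_mat q * inverse_fourier_mat q) $$ (i, j)"
    using ij ramanujan_sum_eq[of q i j] by (simp add: ramanujan_mat_def)
qed (auto simp: ramanujan_mat_def fourier_mat_def inverse_fourier_mat_def)

lemma similar_ramanujan_mat:
  assumes "q > 0"
  shows "similar_mat (ramanujan_mat q) (ramanujan_diag_mat q)"
proof (rule similar_matI)
  show carrier: "{ramanujan_mat q, ramanujan_diag_mat q, fourier_mat q, inverse_fourier_mat q}
      \<subseteq> carrier_mat q q"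
    by (auto simp: ramanujan_mat_def ramanujan_diag_mat_def fourier_mat_def inverse_fourier_mat_def)
  show "fourier_mat q * inverse_fourier_mat q = 1\<^sub>m q"
    using assms by (rule fourier_mat_inverse)
  \<comment> \<open>For square matrices over a field a right inverse is also a left inverse, so no
    second orthogonality relation is needed.\<close>
  with carrier show "inverse_fourier_mat q * fourier_mat q = 1\<^sub>m q"
    by (auto intro: mat_mult_left_right_inverse)
qed (rule ramanujan_mat_factorization[OF assms])

lemma card_coprime_Suc: "card {k. k < q \<and> coprime (Suc k) q} = totient q"
  unfolding totient_def
  by (rule bij_betw_same_card, rule bij_betw_byWitness[of _ "\<lambda>k. k - 1" Suc])
    (auto simp: totatives_def)

text \<open>A diagonal matrix is upper triangular, so its characteristic polynomial is the product
  of the linear factors of its diagonal; grouping them by coprimality leaves a count of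
  totatives.\<close>

lemma char_poly_ramanujan_diag_mat:
  "char_poly (ramanujan_diag_mat q) =
     [:0, 1:] ^ (q - totient q) * [:- of_nat q, 1:] ^ totient q"
proof -
  let ?C = "{k. k < q \<and> coprime (Suc k) q}"
  have "char_poly (ramanujan_diag_mat q) = (\<Prod>a\<leftarrow>diag_mat (ramanujan_diag_mat q). [:- a, 1:])"
    by (rule char_poly_upper_triangular[of _ q])
      (auto simp: ramanujan_diag_mat_def upper_triangular_def)
  also have "diag_mat (ramanujan_diag_mat q) = map (ramanujan_diag q) [0..<q]"
    by (auto simp: diag_mat_def ramanujan_diag_mat_def)
  also have "(\<Prod>a\<leftarrow>map (ramanujan_diag q) [0..<q]. [:- a, 1:]) =
      (\<Prod>k<q. [:- ramanujan_diag q k, 1:])"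
    by (simp add: prod.distinct_set_conv_list lessThan_atLeast0 comp_def flip: set_upt)
  also have "\<dots> = (\<Prod>k\<in>{..<q} - ?C. [:0, 1:]) * (\<Prod>k\<in>?C. [:- of_nat q, 1:])"
    by (subst prod.subset_diff[of ?C])
      (auto simp: ramanujan_diag_def intro!: arg_cong2[where f = "(*)"] prod.cong)
  also have "\<dots> = [:0, 1:] ^ (q - totient q) * [:- of_nat q, 1:] ^ totient q"
    by (simp add: card_Diff_subset subset_eq card_coprime_Suc)
  finally show ?thesis .
qed

text \<open>Multiplicities are algebraic, expressed as orders of roots. The case q = 1 is separate
  in the spectrum: there the matrix is (1), and 0 has multiplicity 0.\<close>

theorem theorem1:
  fixes q :: nat
  assumes "q > 0"
  shows "char_poly (ramanujan_mat q) =
           [:0, 1:] ^ (q - totient q) * [:- of_nat q, 1:] ^ totient q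
       \<and> {k. eigenvalue (ramanujan_mat q) k} = (if q = 1 then {of_nat q} else {0, of_nat q})
       \<and> Polynomial.order 0 (char_poly (ramanujan_mat q)) = q - totient q
       \<and> Polynomial.order (of_nat q) (char_poly (ramanujan_mat q)) = totient q"
proof -
  let ?p = "[:0, 1:] ^ (q - totient q) * [:- of_nat q, 1:] ^ totient q :: complex poly"
  have char_poly: "char_poly (ramanujan_mat q) = ?p"
    using char_poly_similar[OF similar_ramanujan_mat[OF assms]] char_poly_ramanujan_diag_mat
    by simp
  have "eigenvalue (ramanujan_mat q) k \<longleftrightarrow> poly ?p k = 0" for k
    using eigenvalue_root_char_poly[of "ramanujan_mat q" q k] char_poly
    by (simp add: ramanujan_mat_def)
  \<comment> \<open>This decides whether the power of the variable in \<open>?p\<close> is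
    nontrivial, that is, whether 0 is a root; q always is one, as \<open>totient q\<close> is
    positive.\<close>
  moreover have "totient q < q \<longleftrightarrow> q \<noteq> 1"
    using assms totient_less[of q] by (cases "q = 1") auto
  ultimately have spectrum:
    "{k. eigenvalue (ramanujan_mat q) k} = (if q = 1 then {of_nat q} else {0, of_nat q})"
    using assms by auto
  have nonzero: "?p \<noteq> 0"
    by simp
  \<comment> \<open>Orders add over products, and the other factor does not vanish at 0 because q
    \<noteq> 0.\<close>
  have "order 0 ?p = q - totient q"
    using assms order_power_n_n[of "0 :: complex" "q - totient q"]
    by (simp add: order_mult[OF nonzero] order_0I)
  moreover have "order (of_nat q) ?p = totient q"
    using assms order_power_n_n[of "of_nat q :: complex" "totient q"]
    by (simp add: order_mult[OF nonzero] order_0I)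
  ultimately show ?thesis
    using char_poly spectrum by simp
qed

end
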